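(* Let $n\ge 1$. The complete graph $K_n$ is a unit rectangle visibility graph if and only if $n\le 4$.
   Context: A finite simple graph $G$ is a unit rectangle visibility graph (URVG) if its vertices $v$ can be represented by closed unit squares $S_v$ in the plane with sides parallel to the coordinate axes and with pairwise disjoint interiors (squares may touch along their boundaries), in such a way that two distinct vertices $v,w$ are adjacent if and only if there is an unobstructed non-degenerate (positive width) horizontal or vertical band of visibility joining $S_v$ and $S_w$. Here a horizontal band of visibility joining $S_v$ and $S_w$ is given by an open interval $I$ of positive length such that for every $y_0\in I$ the line $y=y_0$ meets the interiors of both $S_v$ and $S_w$, and the part of this line between $S_v$ and $S_w$ (possibly a single point if the squares touch) meets the interior of no other square of the representation; vertical bands are defined analogously with the roles of $x$ and $y$ exchanged. *)

theory Defs
  imports "HOL-Analysis.Analysis" "Graph_Theory.Kuratowski"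
begin

definition unit_square :: "(real \<times> real) set \<Rightarrow> bool" where
  "unit_square A \<longleftrightarrow> (\<exists>a b. A = {a..a + 1} \<times> {b..b + 1})"

definition horizontal_line :: "real \<Rightarrow> (real \<times> real) set" where
  "horizontal_line y = {p. snd p = y}"

definition vertical_line :: "real \<Rightarrow> (real \<times> real) set" where
  "vertical_line x = {p. fst p = x}"

text \<open>
  The part of the line \<open>L\<close> between \<open>A\<close> and \<open>B\<close>. If \<open>L\<close> meets \<open>A\<close> in the segment from \<open>p\<close> to \<open>q\<close>
  and \<open>B\<close> in the segment from \<open>r\<close> to \<open>s\<close>, with \<open>p, q, r, s\<close> in this order along \<open>L\<close>, this is the
  closed segment from \<open>q\<close> to \<open>r\<close>; it is a single point if \<open>q = r\<close>. It is only used when \<open>L\<close> meets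
  both sets (otherwise the intersection would be all of the plane).
\<close>
definition part_between ::
    "(real \<times> real) set \<Rightarrow> (real \<times> real) set \<Rightarrow> (real \<times> real) set \<Rightarrow> (real \<times> real) set" where
  "part_between L A B = (\<Inter>p \<in> L \<inter> A. \<Inter>q \<in> L \<inter> B. closed_segment p q)"

definition line_of_sight ::
    "'a set \<Rightarrow> ('a \<Rightarrow> (real \<times> real) set) \<Rightarrow> (real \<times> real) set \<Rightarrow> 'a \<Rightarrow> 'a \<Rightarrow> bool" where
  "line_of_sight V S L v w \<longleftrightarrow>
     L \<inter> interior (S v) \<noteq> {} \<and> L \<inter> interior (S w) \<noteq> {} \<and>
     (\<forall>u \<in> V - {v, w}. part_between L (S v) (S w) \<inter> interior (S u) = {})"

definition visibility_band ::
    "'a set \<Rightarrow> ('a \<Rightarrow> (real \<times> real) set) \<Rightarrow> (real \<Rightarrow> (real \<times> real) set) \<Rightarrow> 'a \<Rightarrow> 'a \<Rightarrow> bool" where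
  "visibility_band V S line v w \<longleftrightarrow>
     (\<exists>a b. a < b \<and> (\<forall>t \<in> {a<..<b}. line_of_sight V S (line t) v w))"

definition URV_representation ::
    "('a, 'b) pre_digraph \<Rightarrow> ('a \<Rightarrow> (real \<times> real) set) \<Rightarrow> bool" where
  "URV_representation G S \<longleftrightarrow>
     (\<forall>v \<in> verts G. unit_square (S v)) \<and>
     pairwise (\<lambda>v w. interior (S v) \<inter> interior (S w) = {}) (verts G) \<and>
     (\<forall>v \<in> verts G. \<forall>w \<in> verts G. v \<noteq> w \<longrightarrow>
        (v \<rightarrow>\<^bsub>G\<^esub> w \<longleftrightarrow>
           visibility_band (verts G) S horizontal_line v w \<or>
           visibility_band (verts G) S vertical_line v w))"

text \<open>
  Here \<^term>\<open>graph G\<close> says that \<open>G\<close> is a finite simple graph (a finite symmetric digraph without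
  loops and multiple arcs), and \<open>u \<rightarrow>\<^bsub>G\<^esub> v\<close> is adjacency.
\<close>
definition URVG :: "('a, 'b) pre_digraph \<Rightarrow> bool" where
  "URVG G \<longleftrightarrow> graph G \<and> (\<exists>S. URV_representation G S)"

end

theory Submission
  imports Defs
begin

text \<open>
  Write \<open>(x v, y v)\<close> for the lower left corner of the square of \<open>v\<close>. If all squares see each other, then
  every pair is joined in exactly one direction: horizontally iff \<open>\<bar>y v - y w\<bar> < 1\<close>, and vertically iff
  \<open>\<bar>x v - x w\<bar> < 1\<close>. In a horizontal triple, the square that is in the middle of the \<open>y\<close>-order covers
  the strip common to the other two, so it cannot also be in the middle of the \<open>x\<close>-order. Hence no four
  squares are pairwise joined in the same direction. For five squares in \<open>y\<close>-order this makes the pairs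
  \<open>14\<close>, \<open>15\<close>, \<open>25\<close> vertical. A vertical pair \<open>24\<close> would close a vertical four-cycle, whose forced chord
  contradicts the rule for triples; so \<open>24\<close> is horizontal, and then so are \<open>23\<close> and \<open>34\<close>. The square
  \<open>3\<close> is therefore leftmost or rightmost among \<open>2\<close>, \<open>3\<close>, \<open>4\<close>, which makes \<open>1\<close>, \<open>2\<close>, \<open>3\<close> or \<open>3\<close>, \<open>4\<close>, \<open>5\<close>
  a horizontal triple with the same middle square in both orders.
\<close>

section \<open>Segments between squares, and reflection in the diagonal\<close>

lemma closed_segment_same_snd:
  "closed_segment (x, t) (y, t) = closed_segment x y \<times> {t :: real}" for x y :: real
  unfolding closed_segment_def by (force simp: algebra_simps)

lemma part_between_horizontal:
  assumes "a + 1 \<le> c" "b \<le> t" "t \<le> b + 1" "d \<le> t" "t \<le> d + 1"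
  shows "part_between (horizontal_line t) ({a..a + 1} \<times> {b..b + 1}) ({c..c + 1} \<times> {d..d + 1})
    = {a + 1..c} \<times> {t}"
proof
  \<comment> \<open>The points on the facing sides already span the smallest of the intersected
    segments; it is a single point when the squares touch.\<close>
  have "(a + 1, t) \<in> horizontal_line t \<inter> ({a..a + 1} \<times> {b..b + 1})"
    and "(c, t) \<in> horizontal_line t \<inter> ({c..c + 1} \<times> {d..d + 1})"
    using assms by (auto simp: horizontal_line_def)
  then have "part_between (horizontal_line t) ({a..a + 1} \<times> {b..b + 1}) ({c..c + 1} \<times> {d..d + 1})
      \<subseteq> closed_segment (a + 1, t) (c, t)"
    unfolding part_between_def by blast
  then show "part_between (horizontal_line t) ({a..a + 1} \<times> {b..b + 1}) ({c..c + 1} \<times> {d..d + 1})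
      \<subseteq> {a + 1..c} \<times> {t}"
    using assms(1) by (simp add: closed_segment_same_snd closed_segment_eq_real_ivl)
next
  show "{a + 1..c} \<times> {t}
      \<subseteq> part_between (horizontal_line t) ({a..a + 1} \<times> {b..b + 1}) ({c..c + 1} \<times> {d..d + 1})"
    using assms unfolding part_between_def horizontal_line_def
    by (auto simp: closed_segment_same_snd closed_segment_eq_real_ivl)
qed

lemma part_between_commute: "part_between L A B = part_between L B A"
proof -
  have "z \<in> part_between L A B \<longleftrightarrow> z \<in> part_between L B A" for z
    unfolding part_between_def INT_iff by (metis closed_segment_commute)
  then show ?thesis by blast
qed

lemma line_of_sight_commute: "line_of_sight V S L v w \<longleftrightarrow> line_of_sight V S L w v"
  unfolding line_of_sight_def by (auto simp: part_between_commute[of L "S v"] insert_commute)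

text \<open>Reflection in the diagonal is linear and injective, so it respects segments and
  intersections. It reduces vertical lines of sight to horizontal ones.\<close>

lemma part_between_swap:
  "part_between (prod.swap ` L) (prod.swap ` A) (prod.swap ` B) = prod.swap ` part_between L A B"
proof -
  have lin: "linear (prod.swap :: real \<times> real \<Rightarrow> real \<times> real)"
    by (rule linearI) auto
  have eq: "part_between (prod.swap ` L) (prod.swap ` A) (prod.swap ` B)
      = (\<Inter>p \<in> L \<inter> A. \<Inter>q \<in> L \<inter> B. prod.swap ` closed_segment p q)"
    unfolding part_between_def image_Int[OF inj_swap, symmetric] image_image
    by (simp only: closed_segment_linear_image[OF lin])
  have mem: "z \<in> prod.swap ` C \<longleftrightarrow> prod.swap z \<in> C" for z :: "real \<times> real" and C
    by (cases z) auto
  show ?thesis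
    unfolding eq by (rule set_eqI) (simp only: mem part_between_def INT_iff)
qed

lemma line_of_sight_swap:
  "line_of_sight V (\<lambda>u. prod.swap ` S u) (prod.swap ` L) v w \<longleftrightarrow> line_of_sight V S L v w"
proof -
  have lin: "linear (prod.swap :: real \<times> real \<Rightarrow> real \<times> real)"
    by (rule linearI) auto
  show ?thesis
    unfolding line_of_sight_def part_between_swap
    by (simp add: interior_injective_linear_image[OF lin inj_swap]
        flip: image_Int[OF inj_swap])
qed

section \<open>Lines of sight in terms of corner coordinates\<close>

definition square_at :: "real \<Rightarrow> real \<Rightarrow> (real \<times> real) set" where
  "square_at x y = {x..x + 1} \<times> {y..y + 1}"

lemma interior_square_at: "interior (square_at x y) = {x<..<x + 1} \<times> {y<..<y + 1}"
  by (simp add: square_at_def interior_Times)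

lemma swap_square_at: "prod.swap ` square_at x y = square_at y x"
  by (simp add: square_at_def product_swap)

lemma disjoint_interior_square_at:
  "interior (square_at x y) \<inter> interior (square_at x' y') = {} \<longleftrightarrow> \<bar>x - x'\<bar> \<ge> 1 \<or> \<bar>y - y'\<bar> \<ge> 1"
proof -
  have "{s<..<s + 1} \<inter> {s'<..<s' + 1} = {} \<longleftrightarrow> \<bar>s - s'\<bar> \<ge> 1" for s s' :: real
    by (auto simp: greaterThanLessThan_empty_iff)
  then show ?thesis
    by (simp add: interior_square_at Times_Int_Times Times_empty)
qed

text \<open>Comparing corners is enough to detect obstacles: in a \<open>separated\<close> family,
  squares whose interiors meet the same horizontal line have corners at least 1 apart in
  \<open>x\<close>. The strict inequalities keep \<open>v\<close> and \<open>w\<close> from counting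
  as obstacles. Exchanging \<open>x\<close> and \<open>y\<close> gives vertical lines.\<close>

definition unobstructed ::
    "'a set \<Rightarrow> ('a \<Rightarrow> real) \<Rightarrow> ('a \<Rightarrow> real) \<Rightarrow> real \<Rightarrow> 'a \<Rightarrow> 'a \<Rightarrow> bool" where
  "unobstructed V x y t v w \<longleftrightarrow>
     t \<in> {y v<..<y v + 1} \<and> t \<in> {y w<..<y w + 1} \<and>
     (\<forall>u \<in> V. min (x v) (x w) < x u \<and> x u < max (x v) (x w) \<longrightarrow> t \<notin> {y u<..<y u + 1})"

lemma unobstructed_commute: "unobstructed V x y t v w \<longleftrightarrow> unobstructed V x y t w v"
  unfolding unobstructed_def by (auto simp: min.commute max.commute)

definition separated :: "'a set \<Rightarrow> ('a \<Rightarrow> real) \<Rightarrow> ('a \<Rightarrow> real) \<Rightarrow> bool" where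
  "separated V x y \<longleftrightarrow> (\<forall>v \<in> V. \<forall>w \<in> V. v \<noteq> w \<longrightarrow> \<bar>x v - x w\<bar> \<ge> 1 \<or> \<bar>y v - y w\<bar> \<ge> 1)"

lemma separated_swap: "separated V x y \<longleftrightarrow> separated V y x"
  unfolding separated_def by blast

lemma line_of_sight_horizontal:
  assumes sep: "separated V x y" and vw: "v \<in> V" "w \<in> V" "v \<noteq> w"
  shows "line_of_sight V (\<lambda>u. square_at (x u) (y u)) (horizontal_line t) v w
    \<longleftrightarrow> unobstructed V x y t v w"
  using vw
proof (induction "x v" "x w" arbitrary: v w rule: linorder_wlog)
  case (sym v w)
  then show ?case
    using line_of_sight_commute unobstructed_commute by metis
next
  case (le v w)
  have meets: "horizontal_line t \<inter> interior (square_at p q) \<noteq> {} \<longleftrightarrow> t \<in> {q<..<q + 1}" for p q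
  proof -
    have "(p + 1/2, t) \<in> horizontal_line t \<inter> interior (square_at p q)" if "t \<in> {q<..<q + 1}"
      using that by (auto simp: interior_square_at horizontal_line_def)
    moreover have "t \<in> {q<..<q + 1}" if "horizontal_line t \<inter> interior (square_at p q) \<noteq> {}"
      using that by (auto simp: interior_square_at horizontal_line_def)
    ultimately show ?thesis by blast
  qed
  show ?case
  proof (cases "t \<in> {y v<..<y v + 1} \<and> t \<in> {y w<..<y w + 1}")
    case False
    then show ?thesis
      unfolding line_of_sight_def unobstructed_def meets by blast
  next
    case True
    have gap: "x p + 1 \<le> x q"
      if "p \<in> V" "q \<in> V" "p \<noteq> q" "x p \<le> x q" "t \<in> {y p<..<y p + 1}" "t \<in> {y q<..<y q + 1}" for p q
      using sep that unfolding separated_def by force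
    have pb: "part_between (horizontal_line t) (square_at (x v) (y v)) (square_at (x w) (y w))
        = {x v + 1..x w} \<times> {t}"
      unfolding square_at_def
      by (rule part_between_horizontal) (use True gap[of v w] le in auto)
    have "{x v + 1..x w} \<times> {t} \<inter> interior (square_at (x u) (y u)) = {} \<longleftrightarrow>
        (x v < x u \<and> x u < x w \<longrightarrow> t \<notin> {y u<..<y u + 1})" if u: "u \<in> V - {v, w}" for u
    proof (cases "t \<in> {y u<..<y u + 1}")
      case t: True
      show ?thesis
      proof (cases "x v < x u \<and> x u < x w")
        case between: True
        \<comment> \<open>The obstacle fits between the two squares with its whole width, so the
          midpoint of its chord lies on the segment.\<close>
        have "x v + 1 \<le> x u" "x u + 1 \<le> x w"
          using gap[of v u] gap[of u w] u True t between le by auto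
        then have "(x u + 1/2, t) \<in> {x v + 1..x w} \<times> {t} \<inter> interior (square_at (x u) (y u))"
          using t by (auto simp: interior_square_at)
        then show ?thesis
          using between t by blast
      next
        case False
        then show ?thesis by (auto simp: interior_square_at)
      qed
    qed (auto simp: interior_square_at)
    then show ?thesis
      using True le(1) unfolding line_of_sight_def unobstructed_def meets pb
      by auto
  qed
qed

lemma line_of_sight_vertical:
  assumes "separated V x y" "v \<in> V" "w \<in> V" "v \<noteq> w"
  shows "line_of_sight V (\<lambda>u. square_at (x u) (y u)) (vertical_line t) v w
    \<longleftrightarrow> unobstructed V y x t v w"
proof -
  have "vertical_line t = prod.swap ` horizontal_line t"
    by (force simp: vertical_line_def horizontal_line_def)
  then have "line_of_sight V (\<lambda>u. square_at (x u) (y u)) (vertical_line t) v w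
      \<longleftrightarrow> line_of_sight V (\<lambda>u. square_at (y u) (x u)) (horizontal_line t) v w"
    using line_of_sight_swap[of V "\<lambda>u. square_at (y u) (x u)" "horizontal_line t" v w]
    by (simp add: swap_square_at)
  also have "\<dots> \<longleftrightarrow> unobstructed V y x t v w"
    using assms by (intro line_of_sight_horizontal) (simp_all add: separated_swap)
  finally show ?thesis .
qed

section \<open>At most four pairwise visible squares\<close>

definition all_visible :: "'a set \<Rightarrow> ('a \<Rightarrow> real) \<Rightarrow> ('a \<Rightarrow> real) \<Rightarrow> bool" where
  "all_visible V x y \<longleftrightarrow> separated V x y \<and>
     (\<forall>v \<in> V. \<forall>w \<in> V. v \<noteq> w \<longrightarrow>
       (\<exists>t. unobstructed V x y t v w) \<or> (\<exists>t. unobstructed V y x t v w))"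

lemma all_visible_swap: "all_visible V x y \<Longrightarrow> all_visible V y x"
  unfolding all_visible_def using separated_swap by blast

text \<open>Disjoint interiors forbid overlap in both projections, while a line of sight forces
  overlap in one.\<close>

lemma all_visible_exclusive:
  assumes "all_visible V x y" "v \<in> V" "w \<in> V" "v \<noteq> w"
  shows "\<bar>y v - y w\<bar> < 1 \<longleftrightarrow> \<bar>x v - x w\<bar> \<ge> 1"
proof -
  have "\<bar>x v - x w\<bar> \<ge> 1 \<or> \<bar>y v - y w\<bar> \<ge> 1"
    using assms unfolding all_visible_def separated_def by blast
  moreover have "(\<exists>t. unobstructed V x y t v w) \<or> (\<exists>t. unobstructed V y x t v w)"
    using assms unfolding all_visible_def by blast
  then have "\<bar>y v - y w\<bar> < 1 \<or> \<bar>x v - x w\<bar> < 1"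
    unfolding unobstructed_def by auto
  ultimately show ?thesis by linarith
qed

lemma all_visible_unobstructed:
  assumes "all_visible V x y" "v \<in> V" "w \<in> V" "v \<noteq> w" "\<bar>y v - y w\<bar> < 1"
  obtains t where "unobstructed V x y t v w"
proof -
  have "\<bar>x v - x w\<bar> \<ge> 1"
    using all_visible_exclusive assms by metis
  then have "\<not> unobstructed V y x t v w" for t
    unfolding unobstructed_def by auto
  then show ?thesis
    using assms that unfolding all_visible_def by blast
qed

text \<open>A line of sight from \<open>p\<close> to \<open>r\<close> has height between
  \<open>y r\<close> and \<open>y p + 1\<close>, hence runs through the strip of \<open>q\<close>.
  So \<open>q\<close> cannot lie between them in \<open>x\<close>, and the horizontal overlaps make
  the distances at least 1.\<close>

lemma all_visible_no_block:
  assumes vis: "all_visible V x y" and V: "p \<in> V" "q \<in> V" "r \<in> V" "p \<noteq> r" "p \<noteq> q" "q \<noteq> r"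
    and y: "y p \<le> y q" "y q \<le> y r" "y r < y p + 1"
  shows "(x q + 1 \<le> x p \<and> x q + 1 \<le> x r) \<or> (x p + 1 \<le> x q \<and> x r + 1 \<le> x q)"
proof -
  have "\<bar>y p - y r\<bar> < 1" using y by auto
  then obtain t where t: "unobstructed V x y t p r"
    using all_visible_unobstructed[OF vis, of p r] V by blast
  have "\<bar>x p - x q\<bar> \<ge> 1" "\<bar>x q - x r\<bar> \<ge> 1"
    using all_visible_exclusive[OF vis, of p q] all_visible_exclusive[OF vis, of q r] V y by auto
  moreover have "t \<in> {y q<..<y q + 1}"
    using t y unfolding unobstructed_def by auto
  then have "\<not> (min (x p) (x r) < x q \<and> x q < max (x p) (x r))"
    using t V unfolding unobstructed_def by blast
  ultimately show ?thesis by (auto simp: min_def max_def split: if_splits)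
qed

lemma sorted_key_enumeration:
  fixes f :: "'a \<Rightarrow> 'b :: linorder"
  assumes "finite A"
  obtains xs where "set xs = A" "distinct xs" "sorted (map f xs)" "length xs = card A"
proof -
  obtain xs where "set xs = A" "distinct xs"
    using finite_distinct_list[OF assms] by blast
  then show ?thesis
    using that[of "sort_key f xs"] distinct_card[of xs] by simp
qed

text \<open>If four squares met a common strip, then the inner two of the \<open>y\<close>-order would be the outer two
  of the \<open>x\<close>-order, and the other two together would hide them from each other.\<close>

lemma all_visible_no_four_clique:
  assumes vis: "all_visible V x y" and A: "A \<subseteq> V" "card A = 4"
  shows "\<exists>u \<in> A. \<exists>v \<in> A. y u + 1 \<le> y v"
proof (rule ccontr)
  assume no: "\<not> ?thesis"
  have "finite A" using A(2) card.infinite by force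
  then obtain ps where ps: "set ps = A" "distinct ps" "sorted (map y ps)" "length ps = 4"
    using sorted_key_enumeration[of A y] A(2) by metis
  then obtain p q r s where [simp]: "ps = [p, q, r, s]"
    by (auto simp: numeral_eq_Suc length_Suc_conv)
  have V: "p \<in> V" "q \<in> V" "r \<in> V" "s \<in> V" and dist: "distinct [p, q, r, s]"
    and y: "y p \<le> y q" "y q \<le> y r" "y r \<le> y s" and sp: "y s < y p + 1"
    using ps A(1) no by auto
  note block = all_visible_no_block[OF vis]
  \<comment> \<open>The four triples make \<open>q\<close> and \<open>r\<close> each extreme in the
    \<open>x\<close>-order of all four squares, hence at opposite ends.\<close>
  have "x q < min (x p) (x s) \<and> max (x p) (x s) < x r \<or> x r < min (x p) (x s) \<and> max (x p) (x s) < x q"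
    using block[of p q r] block[of p q s] block[of p r s] block[of q r s] V dist y sp by auto
  then have between: "min (x q) (x r) < x u \<and> x u < max (x q) (x r)" if "u \<in> {p, s}" for u
    using that by auto
  have "\<bar>y q - y r\<bar> < 1" using y sp by auto
  then obtain t where t: "unobstructed V x y t q r"
    using all_visible_unobstructed[OF vis, of q r] V dist by auto
  \<comment> \<open>As \<open>y r < t < y q + 1\<close>, missing \<open>p\<close> forces
    \<open>t \<ge> y p + 1\<close> and missing \<open>s\<close> forces \<open>t \<le> y s\<close>,
    against \<open>sp\<close>.\<close>
  then have "t \<notin> {y p<..<y p + 1}" "t \<notin> {y s<..<y s + 1}"
    using between V unfolding unobstructed_def by blast+
  then show False
    using t y sp unfolding unobstructed_def by auto
qed

lemma all_visible_no_five:
  assumes vis: "all_visible V x y"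
    and V: "{p1, p2, p3, p4, p5} \<subseteq> V" and dist: "distinct [p1, p2, p3, p4, p5]"
    and y: "y p1 \<le> y p2" "y p2 \<le> y p3" "y p3 \<le> y p4" "y p4 \<le> y p5"
  shows False
proof -
  note excl = all_visible_exclusive[OF vis]
  note block_y = all_visible_no_block[OF vis]
  note block_x = all_visible_no_block[OF all_visible_swap[OF vis]]
  have "\<exists>u \<in> {p1, p2, p3, p4}. \<exists>v \<in> {p1, p2, p3, p4}. y u + 1 \<le> y v"
    using V dist by (intro all_visible_no_four_clique[OF vis]) auto
  then have "y p1 + 1 \<le> y p4" using y by auto
  then have x14: "\<bar>x p1 - x p4\<bar> < 1" and x15: "\<bar>x p1 - x p5\<bar> < 1"
    using excl[of p1 p4] excl[of p1 p5] V dist y by auto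
  have "\<exists>u \<in> {p2, p3, p4, p5}. \<exists>v \<in> {p2, p3, p4, p5}. y u + 1 \<le> y v"
    using V dist by (intro all_visible_no_four_clique[OF vis]) auto
  then have "y p2 + 1 \<le> y p5" using y by auto
  then have x25: "\<bar>x p2 - x p5\<bar> < 1"
    using excl[of p2 p5] V dist y by auto
  have x24: "\<bar>x p2 - x p4\<bar> \<ge> 1"
  proof (rule ccontr)
    assume "\<not> ?thesis"
    then have x24: "\<bar>x p2 - x p4\<bar> < 1" by simp
    \<comment> \<open>The vertical four-cycle is 1-4-2-5; since it is no vertical clique, one of its
      chords 12 and 45 is missing.\<close>
    have "\<exists>u \<in> {p1, p2, p4, p5}. \<exists>v \<in> {p1, p2, p4, p5}. x u + 1 \<le> x v"
      using V dist by (intro all_visible_no_four_clique[OF all_visible_swap[OF vis]]) auto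
    then have "\<bar>x p1 - x p2\<bar> \<ge> 1 \<or> \<bar>x p4 - x p5\<bar> \<ge> 1"
      using x14 x15 x25 x24 by auto
    then consider "x p1 + 1 \<le> x p2" | "x p2 + 1 \<le> x p1" | "x p4 + 1 \<le> x p5" | "x p5 + 1 \<le> x p4"
      by linarith
    \<comment> \<open>If 12 is missing, \<open>p4\<close> and \<open>p5\<close> are within 1 of both
      \<open>p1\<close> and \<open>p2\<close>, so they lie between them in \<open>x\<close>. Either
      order of \<open>p4\<close> and \<open>p5\<close> then makes \<open>p4\<close> the middle, in
      both orders, of a vertical triple with \<open>p5\<close> and one of \<open>p1\<close>,
      \<open>p2\<close>. If 45 is missing, \<open>p2\<close> plays this part, with \<open>p1\<close>
      and one of \<open>p4\<close>, \<open>p5\<close>.\<close>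
    then show False
    proof cases
      case 1
      then show False
        using linear[of "x p4" "x p5"] block_x[of p1 p4 p5] block_x[of p5 p4 p2] V dist y x14 x15 x25 x24 by auto
    next
      case 2
      then show False
        using linear[of "x p4" "x p5"] block_x[of p2 p4 p5] block_x[of p5 p4 p1] V dist y x14 x15 x25 x24 by auto
    next
      case 3
      then show False
        using linear[of "x p1" "x p2"] block_x[of p4 p2 p1] block_x[of p1 p2 p5] V dist y x14 x15 x25 x24 by auto
    next
      case 4
      then show False
        using linear[of "x p1" "x p2"] block_x[of p5 p2 p1] block_x[of p1 p2 p4] V dist y x14 x15 x25 x24 by auto
    qed
  qed
  then have "y p4 < y p2 + 1"
    using excl[of p2 p4] V dist by auto
  then have "x p3 + 1 \<le> x p2 \<and> x p3 + 1 \<le> x p4 \<or> x p2 + 1 \<le> x p3 \<and> x p4 + 1 \<le> x p3"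
    using block_y[of p2 p3 p4] V dist y by auto
  \<comment> \<open>Say \<open>p3\<close> is leftmost. If \<open>p2\<close> comes next, then
    \<open>p1\<close>, within 1 of \<open>p4\<close>, is to the right of \<open>p2\<close>; if
    \<open>p4\<close> comes next, then \<open>p5\<close>, within 1 of \<open>p2\<close>, is to the
    right of \<open>p4\<close>. The next square is thus in the middle of 1, 2, 3 or of 3, 4, 5 in
    both orders.\<close>
  then consider "\<bar>x p1 - x p3\<bar> \<ge> 1" "\<not> (x p2 + 1 \<le> x p1 \<and> x p2 + 1 \<le> x p3)"
      "\<not> (x p1 + 1 \<le> x p2 \<and> x p3 + 1 \<le> x p2)"
    | "\<bar>x p3 - x p5\<bar> \<ge> 1" "\<not> (x p4 + 1 \<le> x p3 \<and> x p4 + 1 \<le> x p5)"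
      "\<not> (x p3 + 1 \<le> x p4 \<and> x p5 + 1 \<le> x p4)"
    using x14 x25 x24 by linarith
  then show False
  proof cases
    case 1
    then show False
      using excl[of p1 p3] block_y[of p1 p2 p3] V dist y by auto
  next
    case 2
    then show False
      using excl[of p3 p5] block_y[of p3 p4 p5] V dist y by auto
  qed
qed

lemma all_visible_card_le_4:
  assumes "all_visible V x y"
  shows "card V \<le> 4"
proof (rule ccontr)
  assume "\<not> ?thesis"
  then obtain A where A: "A \<subseteq> V" "card A = 5" "finite A"
    using obtain_subset_with_card_n[of 5 V] by auto
  then obtain ps where ps: "set ps = A" "distinct ps" "sorted (map y ps)" "length ps = 5"
    using sorted_key_enumeration[of A y] by metis
  then obtain p1 p2 p3 p4 p5 where "ps = [p1, p2, p3, p4, p5]"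
    by (auto simp: numeral_eq_Suc length_Suc_conv)
  then show False
    using all_visible_no_five[OF assms, of p1 p2 p3 p4 p5] ps A(1) by auto
qed

section \<open>The upper bound for representations of complete graphs\<close>

lemma complete_URV_representation_card_le_4:
  assumes G: "K\<^bsub>n\<^esub> G" and S: "URV_representation G S"
  shows "card (verts G) \<le> 4"
proof -
  let ?V = "verts G"
  have "\<forall>v \<in> ?V. \<exists>p. S v = square_at (fst p) (snd p)"
    using S unfolding URV_representation_def unit_square_def square_at_def by auto
  then obtain c where c: "\<And>v. v \<in> ?V \<Longrightarrow> S v = square_at (fst (c v)) (snd (c v))"
    by metis
  define x y where "x v = fst (c v)" and "y v = snd (c v)" for v
  have Sq: "S v = square_at (x v) (y v)" if "v \<in> ?V" for v
    using c that by (simp add: x_def y_def)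
  have sep: "separated ?V x y"
    using S unfolding URV_representation_def separated_def pairwise_def
    by (metis Sq disjoint_interior_square_at)
  have los: "line_of_sight ?V S L v w
      \<longleftrightarrow> line_of_sight ?V (\<lambda>u. square_at (x u) (y u)) L v w" if "v \<in> ?V" "w \<in> ?V" for L v w
    using that Sq unfolding line_of_sight_def by simp
  have "(\<exists>t. unobstructed ?V x y t v w) \<or> (\<exists>t. unobstructed ?V y x t v w)"
    if vw: "v \<in> ?V" "w \<in> ?V" "v \<noteq> w" for v w
  proof -
    have "v \<rightarrow>\<^bsub>G\<^esub> w"
      using G vw unfolding complete_digraph_def by blast
    then have "visibility_band ?V S horizontal_line v w \<or> visibility_band ?V S vertical_line v w"
      using S vw unfolding URV_representation_def by blast
    \<comment> \<open>Each band is weakened to one line inside it, which is the form that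
      \<open>all_visible\<close> asks for.\<close>
    then have "(\<exists>t. line_of_sight ?V S (horizontal_line t) v w)
        \<or> (\<exists>t. line_of_sight ?V S (vertical_line t) v w)"
      unfolding visibility_band_def using dense greaterThanLessThan_iff by metis
    then show ?thesis
      using line_of_sight_horizontal[OF sep vw] line_of_sight_vertical[OF sep vw] los vw by simp
  qed
  then show ?thesis
    using sep by (intro all_visible_card_le_4[of _ x y]) (auto simp: all_visible_def)
qed

section \<open>Representations with at most four squares\<close>

text \<open>Four squares arranged like the blades of a windmill around a square hole of side \<open>1/2\<close>.\<close>

definition windmill_x :: "nat \<Rightarrow> real" where
  "windmill_x i = [0, 1, 1/2, -1/2] ! i"

definition windmill_y :: "nat \<Rightarrow> real" where
  "windmill_y i = [0, 1/2, 3/2, 1] ! i"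

lemma lessThan_4: "{..<4} = {0, 1, 2, 3 :: nat}"
  by auto

lemma windmill_simps:
  "windmill_x 0 = 0" "windmill_x (Suc 0) = 1" "windmill_x 2 = 1/2" "windmill_x 3 = -1/2"
  "windmill_y 0 = 0" "windmill_y (Suc 0) = 1/2" "windmill_y 2 = 3/2" "windmill_y 3 = 1"
  by (simp_all add: windmill_x_def windmill_y_def numeral_eq_Suc)

lemma windmill_separated: "separated {..<4} windmill_x windmill_y"
  unfolding separated_def lessThan_4 by (auto simp: windmill_simps)

text \<open>The opposite pairs 0, 2 and 1, 3 see each other through the hole. Every other pair
  shares a boundary segment of length 1/2, whose projection is the band.\<close>

lemma windmill_visible:
  assumes "i < 4" "j < 4" "i \<noteq> j"
  obtains l u where "l < u"
    "(\<forall>t \<in> {l<..<u}. unobstructed {..<4} windmill_x windmill_y t i j)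
      \<or> (\<forall>t \<in> {l<..<u}. unobstructed {..<4} windmill_y windmill_x t i j)"
proof -
  have "\<exists>l u. l < u \<and>
    ((\<forall>t \<in> {l<..<u}. unobstructed {..<4} windmill_x windmill_y t i j)
      \<or> (\<forall>t \<in> {l<..<u}. unobstructed {..<4} windmill_y windmill_x t i j))"
    using assms
  proof (induction i j rule: linorder_wlog)
    case (sym i j)
    then show ?case by (metis unobstructed_commute)
  next
    case (le i j)
    then consider "i = 0" "j = 1" | "i = 0" "j = 2" | "i = 0" "j = 3"
      | "i = 1" "j = 2" | "i = 1" "j = 3" | "i = 2" "j = 3"
      by linarith
    then show ?case
    proof cases
      case 1
      show ?thesis
        by (rule exI[of _ "1/2"], rule exI[of _ 1])
           (auto simp: 1 unobstructed_def lessThan_4 windmill_simps)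
    next
      case 2
      show ?thesis
        by (rule exI[of _ "1/2"], rule exI[of _ 1])
           (auto simp: 2 unobstructed_def lessThan_4 windmill_simps)
    next
      case 3
      show ?thesis
        by (rule exI[of _ 0], rule exI[of _ "1/2"])
           (auto simp: 3 unobstructed_def lessThan_4 windmill_simps)
    next
      case 4
      show ?thesis
        by (rule exI[of _ 1], rule exI[of _ "3/2"])
           (auto simp: 4 unobstructed_def lessThan_4 windmill_simps)
    next
      case 5
      show ?thesis
        by (rule exI[of _ 1], rule exI[of _ "3/2"])
           (auto simp: 5 unobstructed_def lessThan_4 windmill_simps)
    next
      case 6
      show ?thesis
        by (rule exI[of _ "3/2"], rule exI[of _ 2])
           (auto simp: 6 unobstructed_def lessThan_4 windmill_simps)
    qed
  qed
  then show ?thesis using that by blast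
qed

text \<open>Taking fewer squares only removes obstacles, so the one windmill serves every
  \<open>n \<le> 4\<close>.\<close>

lemma unobstructed_reindex:
  assumes "f ` V \<subseteq> W" "unobstructed W x y t (f v) (f w)"
  shows "unobstructed V (x \<circ> f) (y \<circ> f) t v w"
  using assms unfolding unobstructed_def by auto

lemma complete_URV_representation_exists:
  assumes G: "K\<^bsub>n\<^esub> G" and n: "n \<le> 4"
  obtains S where "URV_representation G S"
proof -
  let ?V = "verts G"
  interpret graph G using G by (simp add: complete_digraph_def)
  have "card ?V \<le> card {..<4 :: nat}"
    using G n by (simp add: complete_digraph_def)
  then obtain f where f: "f ` ?V \<subseteq> {..<4 :: nat}" "inj_on f ?V"
    using card_le_inj[OF finite_verts finite_lessThan] by blast
  define x y where "x = windmill_x \<circ> f" and "y = windmill_y \<circ> f"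
  define S where "S v = square_at (x v) (y v)" for v
  have sep: "separated ?V x y"
    unfolding separated_def x_def y_def o_def
  proof (intro ballI impI)
    fix v w
    assume "v \<in> ?V" "w \<in> ?V" "v \<noteq> w"
    then have "f v \<in> {..<4}" "f w \<in> {..<4}" "f v \<noteq> f w"
      using f by (auto simp: inj_on_def)
    then show "\<bar>windmill_x (f v) - windmill_x (f w)\<bar> \<ge> 1 \<or> \<bar>windmill_y (f v) - windmill_y (f w)\<bar> \<ge> 1"
      using windmill_separated unfolding separated_def by blast
  qed
  have "visibility_band ?V S horizontal_line v w \<or> visibility_band ?V S vertical_line v w"
    if vw: "v \<in> ?V" "w \<in> ?V" "v \<noteq> w" for v w
  proof -
    have "f v < 4" "f w < 4" "f v \<noteq> f w"
      using f vw by (auto simp: inj_on_def)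
    then obtain l u where "l < u" and
      "(\<forall>t \<in> {l<..<u}. unobstructed {..<4} windmill_x windmill_y t (f v) (f w))
        \<or> (\<forall>t \<in> {l<..<u}. unobstructed {..<4} windmill_y windmill_x t (f v) (f w))"
      by (rule windmill_visible)
    then have "(\<forall>t \<in> {l<..<u}. unobstructed ?V x y t v w) \<or> (\<forall>t \<in> {l<..<u}. unobstructed ?V y x t v w)"
      unfolding x_def y_def using unobstructed_reindex[OF f(1)] by blast
    then show ?thesis
      using \<open>l < u\<close> line_of_sight_horizontal[OF sep vw] line_of_sight_vertical[OF sep vw]
      unfolding visibility_band_def S_def by blast
  qed
  moreover have "v \<rightarrow>\<^bsub>G\<^esub> w" if "v \<in> ?V" "w \<in> ?V" "v \<noteq> w" for v w
    using G that by (simp add: complete_digraph_def)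
  moreover have "unit_square (S v)" for v
    unfolding unit_square_def S_def square_at_def by blast
  moreover have "pairwise (\<lambda>v w. interior (S v) \<inter> interior (S w) = {}) ?V"
    using sep unfolding pairwise_def separated_def S_def disjoint_interior_square_at by blast
  ultimately have "URV_representation G S"
    unfolding URV_representation_def by blast
  then show ?thesis using that by blast
qed

theorem theorem3p3:
  fixes G :: "('a, 'b) pre_digraph" and n :: nat
  assumes "n \<ge> 1" and "K\<^bsub>n\<^esub> G"
  shows "URVG G \<longleftrightarrow> n \<le> 4"
proof
  have "graph G" "card (verts G) = n"
    using assms(2) by (simp_all add: complete_digraph_def)
  then show "n \<le> 4" if "URVG G"
    using that complete_URV_representation_card_le_4[OF assms(2)] unfolding URVG_def by metis
  show "URVG G" if "n \<le> 4"
    using \<open>graph G\<close> complete_URV_representation_exists[OF assms(2) that]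
    unfolding URVG_def by metis
qed

end
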